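(* Let $b\ge2$ be an integer, $c\ge2$ real, $\rho=\{\log_b c\}$ with $0<\rho<1$, $B=\log b$, $L=\rho B$, and let $x_j$ be the solution in $(1/L,\infty)$ of $Lx_j-\log x_j=jB$ (for integers $j$ with $jB>1+\log L$). Let $$a=\frac BL=\frac1\rho,\qquad k=\lfloor a\rfloor,\qquad \vartheta=\{a\},\qquad m_j=\lceil x_j\rceil .$$ The real increments $d_j=x_{j+1}-x_j$ satisfy $$d_j=a+\frac1L\int_{jB}^{jB+B}R(u)\,du,$$ so they are strictly decreasing and tend to $a$ from above. If $h=k+1$ and $\delta=h-a$, then $$d_j<h\quad\Longleftrightarrow\quad x_j>\frac{h}{e^{L\delta}-1}.$$ Consequently, from some layer $j_0$ onward, $m_{j+1}-m_j\in\{k,k+1\}$. For $N>j_0$, let $G_+(N)=\#\{j_0\le j<N:m_{j+1}-m_j=k+1\}$. Then $$G_+(N)=m_N-m_{j_0}-k(N-j_0)=\vartheta N+\frac{\log N}{L}+O_{c,b}(1).$$ More uniformly, for all sufficiently large integers $s>r$, $$\#\{r\le j<s:m_{j+1}-m_j=k+1\}=\vartheta(s-r)+\frac1L\log\frac sr+d_+(x_s)-d_+(x_r)+O_{c,b}\left(\frac{\log r}{r}\right).$$ In particular, after subtracting its linear term $\vartheta(s-r)$ and logarithmic drift $\frac1L\log\frac sr$, the interval count has absolute discrepancy less than $1+O_{c,b}((\log r)/r)$, uniformly in $s>r$. In particular, even when $a$ is an integer, the longer gap $k+1$ occurs infinitely often, but (when $a$ is an integer) only $L^{-1}\log N+O(1)$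 times up to layer $N$. Finally, if $j_0$ is chosen so that the large branch is increasing and the one-candidate conclusion holds for every $j\ge j_0$, then for every integer $M>1/L$, $$\#\{j\ge j_0:m_j\le M\}=\max\left\{0,\left\lfloor\rho M-\log_bM\right\rfloor-j_0+1\right\}.$$ Consequently, with $\Phi(x)=\rho x-\log_b x$, for every sufficiently large integer $M$, $$\mathbf 1_{\{M=m_j\text{ for some }j\}}=\lfloor\Phi(M)\rfloor-\lfloor\Phi(M-1)\rfloor.$$
   Context: $\{x\}=x-\lfloor x\rfloor$, $d_+(x)=\lceil x\rceil-x$; $\log$ is the natural logarithm. $G$ denotes the inverse of the strictly increasing function $u\mapsto Lu-\log u$ on $(1/L,\infty)$ (the large branch), defined on $(1+\log L,\infty)$, so $x_j=G(jB)$; equivalently $x_j=-\frac1L W_{-1}(-Lb^{-j})$ with $W_{-1}$ the lower real Lambert branch. $R(J)=1/(LG(J)-1)$. Put $z_j=G(jB+L)-1$; the integers of layer $j$ are those in $[x_j,z_j)$. The condition on $j_0$ in the final part means: for every integer $j\ge j_0$ the roots $x_j,z_j$ are defined on the large branch and $0<z_j-x_j<1$, so that $[x_j,z_j)$ contains at most one integer, necessarily $m_j=\lceil x_j\rceil$. *)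

theory Defs
  imports "HOL-Analysis.Analysis"
begin

definition d_plus :: "real \<Rightarrow> real" where
  "d_plus x = of_int \<lceil>x\<rceil> - x"

text \<open>The inverse of \<open>u \<mapsto> L * u - ln u\<close> on \<open>(1/L, \<infinity>)\<close>. It is meaningful only for
  \<open>L > 0\<close> and \<open>J > 1 + ln L\<close>; see \<open>large_branch_eq_iff\<close> below.\<close>

definition large_branch :: "real \<Rightarrow> real \<Rightarrow> real" where
  "large_branch L = the_inv_into {1/L<..} (\<lambda>u. L * u - ln u)"

definition branch_R :: "real \<Rightarrow> real \<Rightarrow> real" where
  "branch_R L J = 1 / (L * large_branch L J - 1)"

text \<open>The integers \<open>j\<close> for which \<open>x\<^sub>j = large_branch L (j * B)\<close> is defined.\<close>

definition layers :: "real \<Rightarrow> real \<Rightarrow> int set" where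
  "layers L B = {j. of_int j * B > 1 + ln L}"

lemma branch_strict_mono:
  fixes L :: real
  assumes "L > 0"
  shows "strict_mono_on {1/L<..} (\<lambda>u. L * u - ln u)"
proof (rule strict_mono_onI)
  fix u v :: real
  assume u: "u \<in> {1/L<..}" and v: "v \<in> {1/L<..}" and uv: "u < v"
  have u0: "1/L < u" using u by simp
  moreover have "0 < 1/L" using assms by simp
  ultimately have up: "u > 0" by linarith
  have Lu: "L * u > 1" using u0 assms by (simp add: field_simps)
  have "ln v - ln u = ln (v/u)" using up uv by (simp add: ln_div)
  also have "\<dots> \<le> v/u - 1" using up uv by (intro ln_le_minus_one) simp
  also have "\<dots> = (v - u) / u" using up by (simp add: field_simps)
  also have "\<dots> < L * (v - u)"
  proof -
    have "(v - u) * 1 < (v - u) * (L * u)" using Lu uv by (intro mult_strict_left_mono) auto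
    then show ?thesis using up by (simp add: divide_less_eq mult.commute mult.left_commute)
  qed
  finally show "L * u - ln u < L * v - ln v" by (simp add: algebra_simps)
qed

lemma branch_surj:
  fixes L J :: real
  assumes L: "L > 0" and J: "J > 1 + ln L"
  obtains u where "u > 1/L" "L * u - ln u = J"
proof -
  define U where "U = max (1/L) (2 * (J - 1 + ln (2/L)) / L)"
  have iL: "1/L > 0" using L by simp
  have U1: "1/L \<le> U" unfolding U_def by simp
  have U0: "U > 0" using U1 iL by linarith
  have "ln (L * U / 2) + ln (2/L) = ln (L * U / 2 * (2/L))"
    using L U0 by (subst ln_mult) auto
  also have "L * U / 2 * (2/L) = U" using L by simp
  finally have "ln U = ln (L * U / 2) + ln (2/L)" by simp
  also have "ln (L * U / 2) \<le> L * U / 2 - 1" using L U0 by (intro ln_le_minus_one) simp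
  finally have 1: "ln U \<le> L * U / 2 - 1 + ln (2/L)" by simp
  have "2 * (J - 1 + ln (2/L)) / L \<le> U" unfolding U_def by simp
  then have "2 * (J - 1 + ln (2/L)) \<le> L * U" using L by (simp add: divide_le_eq mult.commute)
  then have "J \<le> L * U / 2 + 1 - ln (2/L)" by (simp add: algebra_simps)
  also have "\<dots> \<le> L * U - ln U" using 1 by (simp add: algebra_simps)
  finally have hi: "J \<le> L * U - ln U" .
  have at_min: "L * (1/L) - ln (1/L) = 1 + ln L" using L by (simp add: ln_div)
  have "continuous_on {1/L..U} (\<lambda>u. L * u - ln u)"
    using iL by (intro continuous_intros) auto
  then obtain u where u: "1/L \<le> u" "L * u - ln u = J"
    using IVT'[of "\<lambda>u. L * u - ln u" "1/L" J U] at_min J hi U1 by auto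
  have "u \<noteq> 1/L" using u at_min J by force
  with u show ?thesis by (intro that[of u]) auto
qed

lemma large_branch_eq_iff:
  fixes L J u :: real
  assumes "L > 0" "J > 1 + ln L"
  shows "u = large_branch L J \<longleftrightarrow> u > 1/L \<and> L * u - ln u = J"
proof -
  have inj: "inj_on (\<lambda>u. L * u - ln u) {1/L<..}"
    using branch_strict_mono[OF assms(1)] by (rule strict_mono_on_imp_inj_on)
  obtain v where v: "v > 1/L" "L * v - ln v = J"
    using branch_surj[OF assms] .
  have "large_branch L J = v"
    unfolding large_branch_def using v by (intro the_inv_into_f_eq[OF inj]) auto
  moreover have "u = v" if "u > 1/L" "L * u - ln u = J"
    using inj_onD[OF inj, of u v] that v by simp
  ultimately show ?thesis using v by blast
qed

end

theory Submission
  imports Defs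
begin

text \<open>
Write \<open>\<phi> u = L * u - ln u\<close> and \<open>G\<close> for its inverse on \<open>(1/L, \<infinity>)\<close>, so that \<open>x\<^sub>j = G (j * B)\<close>. Everything
rests on two ways of reading \<open>\<phi> (x\<^sub>j) = j * B\<close>.

As a differential equation it gives \<open>G' = (1 + R) / L\<close> with \<open>R\<close> positive, strictly decreasing and
tending to \<open>0\<close>. Hence for fixed \<open>t > 0\<close> the increment \<open>G (J + t) - G J\<close> strictly decreases in \<open>J\<close>
towards its infimum \<open>t / L\<close> (\<open>branch_increment_bounds\<close>, \<open>branch_increment_strict_antimono\<close>,
\<open>branch_increment_tendsto\<close>). With \<open>t = B\<close> this is the behaviour of \<open>d\<^sub>j\<close>: eventually
\<open>k \<le> a < d\<^sub>j < k + 1\<close>, and then the ceilings of \<open>x\<^sub>j\<close> and \<open>x\<^sub>j\<^sub>+\<^sub>1\<close> are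
\<open>k\<close> or \<open>k + 1\<close> apart. With \<open>t = L\<close> the increment is \<open>z\<^sub>j - x\<^sub>j + 1\<close>, which eventually lies in \<open>(1, 2)\<close>.

As an identity it reads \<open>x\<^sub>j = a * j + ln (x\<^sub>j) / L\<close>. Since the gaps are \<open>k\<close> or \<open>k + 1\<close>, the number of
long ones telescopes to \<open>m\<^sub>s - m\<^sub>r - k * (s - r)\<close>, and substituting \<open>m\<^sub>j = x\<^sub>j + d\<^sub>+(x\<^sub>j)\<close> and then the identity turns
this into the exact formula
\<open>\<theta> * (s - r) + (ln (x\<^sub>s) - ln (x\<^sub>r)) / L + d\<^sub>+(x\<^sub>s) - d\<^sub>+(x\<^sub>r)\<close> (\<open>card_long_gaps_exact\<close>). All error terms
therefore come from a single estimate, \<open>ln (x\<^sub>j) = ln j + ln a + O(ln j / j)\<close> (\<open>ln_root_approx\<close>); the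
count diverges even when \<open>\<theta> = 0\<close> because of the logarithm.

For the ceilings themselves, monotonicity of \<open>\<phi>\<close> makes \<open>m\<^sub>j \<le> M\<close> equivalent to \<open>j \<le> \<phi> M / B\<close>, that is, to
\<open>j \<le> \<Phi> M\<close> (\<open>ceil_root_le_iff\<close>). So \<open>M\<close> is a ceiling iff an integer lies in \<open>(\<Phi> (M - 1), \<Phi> M]\<close>; this
interval is shorter than \<open>1\<close> because \<open>L < B\<close>, so the difference of the two floors is its indicator.
\<close>

section \<open>The large branch\<close>

lemma branch_root:
  assumes "L > 0" "J > 1 + ln L"
  shows "large_branch L J > 1/L" "L * large_branch L J - ln (large_branch L J) = J"
  using large_branch_eq_iff[OF assms] by auto

lemma branch_pos:
  assumes "L > 0" "J > 1 + ln L"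
  shows "large_branch L J > 0"
  using branch_root(1)[OF assms] assms(1) by (meson less_trans zero_less_divide_1_iff)

text \<open>Turns the admissibility condition \<open>J > 1 + ln L\<close> into one on arguments: \<open>1 + ln L\<close> is the value of
\<open>u \<mapsto> L * u - ln u\<close> at its minimum \<open>1/L\<close>, and \<open>ln v < v - 1\<close> for \<open>v = L * u \<noteq> 1\<close>.\<close>

lemma level_gt_minimum:
  fixes L u :: real
  assumes "L > 0" "u > 1/L"
  shows "1 + ln L < L * u - ln u"
proof -
  have "u > 0" using assms by (meson less_trans zero_less_divide_1_iff)
  have "ln (L * u) < L * u - 1"
    using ln_le_minus_one[of "L * u"] ln_eq_minus_one[of "L * u"] assms \<open>u > 0\<close>
    by (auto simp: field_simps less_le)
  then show ?thesis using assms(1) \<open>u > 0\<close> by (simp add: ln_mult)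
qed

lemma branch_le_iff:
  assumes "L > 0" "J > 1 + ln L" "u > 1/L"
  shows "large_branch L J \<le> u \<longleftrightarrow> J \<le> L * u - ln u"
  using strict_mono_on_less_eq[OF branch_strict_mono[OF assms(1)], of "large_branch L J" u]
    branch_root[OF assms(1,2)] assms(3) by simp

lemma branch_less_iff:
  assumes "L > 0" "J > 1 + ln L" "u > 1/L"
  shows "large_branch L J < u \<longleftrightarrow> J < L * u - ln u"
  using strict_mono_on_less[OF branch_strict_mono[OF assms(1)], of "large_branch L J" u]
    branch_root[OF assms(1,2)] assms(3) by simp

lemma branch_mono_less:
  assumes "L > 0" "J > 1 + ln L" "J < K"
  shows "large_branch L J < large_branch L K"
  using branch_less_iff[OF assms(1,2) branch_root(1), of K] branch_root(2)[of L K] assms by simp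

text \<open>Inserting \<open>G J > 1/L\<close> into the logarithm of \<open>L * G J = J + ln (G J)\<close> bounds \<open>G J\<close> below by a linear
function of \<open>J\<close>.\<close>

lemma branch_tends_to_infinity:
  assumes L: "L > 0"
  shows "filterlim (large_branch L) at_top at_top"
  unfolding filterlim_at_top
proof
  fix Z
  show "\<forall>\<^sub>F J in at_top. Z \<le> large_branch L J"
    using eventually_gt_at_top[of "1 + ln L"] eventually_ge_at_top[of "L * Z + ln L"]
  proof eventually_elim
    case (elim J)
    have "ln (1/L) \<le> ln (large_branch L J)"
      using branch_root(1)[OF L elim(1)] branch_pos[OF L elim(1)] L by (subst ln_le_cancel_iff) auto
    then have "- ln L \<le> ln (large_branch L J)" using L by (simp add: ln_div)
    then have "L * Z \<le> L * large_branch L J"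
      using branch_root(2)[OF L elim(1)] elim(2) by linarith
    then show ?case using L by simp
  qed
qed

lemma branch_R_pos:
  assumes "L > 0" "J > 1 + ln L"
  shows "0 < branch_R L J"
  using branch_root(1)[OF assms] assms(1) by (simp add: branch_R_def field_simps)

lemma branch_R_strict_antimono:
  assumes "L > 0" "J > 1 + ln L" "J < K"
  shows "branch_R L K < branch_R L J"
proof -
  have "0 < L * large_branch L J - 1"
    using branch_root(1)[OF assms(1,2)] assms(1) by (simp add: field_simps)
  moreover have "L * large_branch L J - 1 < L * large_branch L K - 1"
    using branch_mono_less[OF assms] assms(1) by simp
  ultimately show ?thesis
    unfolding branch_R_def by (intro divide_strict_left_mono mult_pos_pos) linarith+
qed

lemma branch_R_tendsto_0:
  assumes "L > 0"
  shows "(branch_R L \<longlongrightarrow> 0) at_top"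
proof -
  have "filterlim (\<lambda>J. L * large_branch L J) at_top at_top"
    using assms branch_tends_to_infinity[OF assms]
    by (intro filterlim_tendsto_pos_mult_at_top[OF tendsto_const])
  then have "filterlim (\<lambda>J. - 1 + L * large_branch L J) at_top at_top"
    by (intro filterlim_tendsto_add_at_top[OF tendsto_const])
  from tendsto_inverse_0_at_top[OF this]
  show ?thesis by (simp add: branch_R_def[abs_def] inverse_eq_divide)
qed

text \<open>The inverse function rule gives \<open>1 / (L - 1/y) = y / (L * y - 1)\<close> at \<open>y = G J\<close>; splitting off the limit
\<open>1/L\<close> leaves a multiple of \<open>branch_R\<close>, so that monotonicity and decay of \<open>G'\<close> can be read off from those
of \<open>branch_R\<close>.\<close>

lemma branch_has_derivative:
  assumes L: "L > 0" and J: "J > 1 + ln L"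
  shows "(large_branch L has_real_derivative (1 + branch_R L J) / L) (at J)"
proof -
  define y where "y = large_branch L J"
  define f where "f = (\<lambda>u. L * u - ln u)"
  have y: "y > 1/L" "f y = J" "y > 0"
    using branch_root[OF L J] branch_pos[OF L J] by (auto simp: y_def f_def)
  have Ly: "L * y > 1" using y L by (simp add: field_simps)
  have pos: "u > 0" if "u > 1/L" for u using that L by (meson less_trans zero_less_divide_1_iff)
  have "DERIV (large_branch L) (f y) :> inverse (L - 1 / y)"
    unfolding has_field_derivative_def
  proof (rule has_derivative_inverse_strong[where S = "{1/L<..}" and x = y and f = f and g = "large_branch L"
        and f' = "(*) (L - 1 / y)" and g' = "(*) (inverse (L - 1 / y))"])
    have "DERIV f y :> L - 1 / y"
      unfolding f_def using y by (auto intro!: derivative_eq_intros)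
    then show "(f has_derivative (*) (L - 1 / y)) (at y)"
      by (simp add: has_field_derivative_def)
    have "L - 1 / y \<noteq> 0" using Ly y by (auto simp: field_simps)
    then show "(*) (L - 1 / y) \<circ> (*) (inverse (L - 1 / y)) = id" by (auto simp: fun_eq_iff)
    show "continuous_on {1/L<..} f"
      unfolding f_def by (intro continuous_intros) (auto dest: pos)
    show "large_branch L (f u) = u" if "u \<in> {1/L<..}" for u
      using that large_branch_eq_iff[OF L level_gt_minimum[OF L], of u u] by (simp add: f_def)
  qed (use y in auto)
  also have "inverse (L - 1 / y) = (1 + branch_R L J) / L"
    using Ly y L by (simp add: branch_R_def flip: y_def) (simp add: field_simps)
  finally show ?thesis using y by simp
qed

section \<open>Increments of the branch\<close>

text \<open>The fundamental theorem applied to \<open>G' = (1 + R) / L\<close>. Integrability of \<open>R\<close> comes out of the same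
theorem, as \<open>R\<close> is an affine function of \<open>G'\<close>.\<close>

lemma branch_increment_integral:
  assumes L: "L > 0" and J: "J > 1 + ln L" and t: "t \<ge> 0"
  shows "branch_R L integrable_on {J..J + t}"
    and "large_branch L (J + t) - large_branch L J = t / L + 1 / L * integral {J..J + t} (branch_R L)"
proof -
  have G: "((\<lambda>u. (1 + branch_R L u) / L) has_integral large_branch L (J + t) - large_branch L J) {J..J + t}"
    using t J branch_has_derivative[OF L]
    by (intro fundamental_theorem_of_calculus)
       (auto simp flip: has_real_derivative_iff_has_vector_derivative intro: has_field_derivative_at_within)
  have "((\<lambda>u. L * ((1 + branch_R L u) / L) - 1) has_integral
      L * (large_branch L (J + t) - large_branch L J) - t) {J..J + t}"
    using t has_integral_diff[OF has_integral_mult_right[OF G, of L] has_integral_const_real[of 1 J "J + t"]]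
    by simp
  then have R: "(branch_R L has_integral L * (large_branch L (J + t) - large_branch L J) - t) {J..J + t}"
    using L by simp
  then show "branch_R L integrable_on {J..J + t}" by blast
  show "large_branch L (J + t) - large_branch L J = t / L + 1 / L * integral {J..J + t} (branch_R L)"
    using integral_unique[OF R] L by (simp add: field_simps)
qed

lemma branch_increment_mvt:
  assumes L: "L > 0" and J: "J > 1 + ln L" and t: "t > 0"
  obtains u where "J < u" "u < J + t"
    "large_branch L (J + t) - large_branch L J = t * ((1 + branch_R L u) / L)"
  using MVT2[of J "J + t" "large_branch L" "\<lambda>u. (1 + branch_R L u) / L"] t J
    branch_has_derivative[OF L] by auto

text \<open>By the mean value theorem the increment is \<open>t * G' u\<close> for some \<open>u > J\<close>, and \<open>0 < R u < R J\<close>.\<close>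

lemma branch_increment_bounds:
  assumes L: "L > 0" and J: "J > 1 + ln L" and t: "t > 0"
  shows "t / L < large_branch L (J + t) - large_branch L J"
    and "large_branch L (J + t) - large_branch L J < t / L * (1 + branch_R L J)"
proof -
  obtain u where u: "J < u" "u < J + t"
    "large_branch L (J + t) - large_branch L J = t * ((1 + branch_R L u) / L)"
    using branch_increment_mvt[OF assms] .
  show "t / L < large_branch L (J + t) - large_branch L J"
    using u branch_R_pos[OF L, of u] J t L by (simp add: field_simps)
  show "large_branch L (J + t) - large_branch L J < t / L * (1 + branch_R L J)"
    using u branch_R_strict_antimono[OF L J u(1)] t L by (simp add: divide_simps)
qed

text \<open>The increment has derivative \<open>G' (u + t) - G' u\<close>, which is negative since \<open>G'\<close> decreases.\<close>

lemma branch_increment_strict_antimono: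
  assumes L: "L > 0" and J: "J > 1 + ln L" and t: "t > 0" and JK: "J < K"
  shows "large_branch L (K + t) - large_branch L K < large_branch L (J + t) - large_branch L J"
proof (rule DERIV_neg_imp_decreasing[OF JK])
  fix u assume u: "J \<le> u" "u \<le> K"
  then have "((\<lambda>u. large_branch L (u + t) - large_branch L u) has_real_derivative
      (1 + branch_R L (u + t)) / L - (1 + branch_R L u) / L) (at u)"
    using J t by (intro DERIV_diff branch_has_derivative DERIV_shift[THEN iffD1] L) auto
  moreover have "(1 + branch_R L (u + t)) / L - (1 + branch_R L u) / L < 0"
    using branch_R_strict_antimono[OF L, of u "u + t"] u J t L by (simp add: divide_simps)
  ultimately show "\<exists>y. ((\<lambda>u. large_branch L (u + t) - large_branch L u) has_real_derivative y) (at u) \<and> y < 0"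
    by blast
qed

lemma branch_increment_tendsto:
  assumes L: "L > 0" and t: "t > 0"
  shows "((\<lambda>J. large_branch L (J + t) - large_branch L J) \<longlongrightarrow> t / L) at_top"
proof (rule tendsto_sandwich[where f = "\<lambda>_. t / L" and h = "\<lambda>J. t / L * (1 + branch_R L J)"])
  show "((\<lambda>J. t / L * (1 + branch_R L J)) \<longlongrightarrow> t / L) at_top"
    using L by (auto intro!: tendsto_eq_intros branch_R_tendsto_0)
  show "\<forall>\<^sub>F J in at_top. t / L \<le> large_branch L (J + t) - large_branch L J"
    using eventually_gt_at_top[of "1 + ln L"]
    by eventually_elim (use branch_increment_bounds(1)[OF L _ t] in force)
  show "\<forall>\<^sub>F J in at_top. large_branch L (J + t) - large_branch L J \<le> t / L * (1 + branch_R L J)"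
    using eventually_gt_at_top[of "1 + ln L"]
    by eventually_elim (use branch_increment_bounds(2)[OF L _ t] in force)
qed simp


section \<open>The layers\<close>

text \<open>The base \<open>b\<close> and the constant \<open>c\<close> enter only through \<open>B\<close> and \<open>L\<close>. In the names of the statement, \<open>root\<close> is
\<open>x\<close>, \<open>ceil_root\<close> is \<open>m\<close> and \<open>min_gap\<close> is \<open>k\<close>.\<close>

locale log_layers =
  fixes L B :: real
  assumes L_pos: "0 < L" and B_pos: "0 < B"
begin

abbreviation root :: "int \<Rightarrow> real" where
  "root j \<equiv> large_branch L (of_int j * B)"

abbreviation ceil_root :: "int \<Rightarrow> int" where
  "ceil_root j \<equiv> \<lceil>root j\<rceil>"

abbreviation min_gap :: int where
  "min_gap \<equiv> \<lfloor>B / L\<rfloor>"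

abbreviation two_gaps_from :: "int \<Rightarrow> bool" where
  "two_gaps_from j0 \<equiv> j0 \<in> layers L B \<and>
     (\<forall>j\<ge>j0. ceil_root (j + 1) - ceil_root j \<in> {min_gap, min_gap + 1})"

definition long_gaps :: "int \<Rightarrow> int \<Rightarrow> int set" where
  "long_gaps r s = {j. r \<le> j \<and> j < s \<and> ceil_root (j + 1) - ceil_root j = min_gap + 1}"

lemma layers_upward:
  assumes "i \<in> layers L B" "i \<le> j"
  shows "j \<in> layers L B"
proof -
  have "of_int i * B \<le> of_int j * B" using assms(2) B_pos by simp
  then show ?thesis using assms(1) unfolding layers_def mem_Collect_eq by linarith
qed

lemma level_at_top: "filterlim (\<lambda>j::int. of_int j * B) at_top at_top"
  by (rule filterlim_at_top_mult_tendsto_pos[OF tendsto_const B_pos filterlim_real_of_int_at_top])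

lemma eventually_layers: "\<forall>\<^sub>F j in at_top. j \<in> layers L B"
  using filterlim_at_top_dense[THEN iffD1, OF level_at_top] by (simp add: layers_def)

lemma root_at_top: "filterlim root at_top at_top"
  by (rule filterlim_compose[OF branch_tends_to_infinity[OF L_pos] level_at_top])

lemma root_pos: "j \<in> layers L B \<Longrightarrow> 0 < root j"
  using branch_pos[OF L_pos] by (simp add: layers_def)

lemma root_eq: "j \<in> layers L B \<Longrightarrow> root j = B / L * of_int j + ln (root j) / L"
  using branch_root(2)[OF L_pos, of "of_int j * B"] L_pos by (simp add: layers_def field_simps)

subsection \<open>Real increments\<close>

lemma root_Suc: "root (j + 1) = large_branch L (of_int j * B + B)"
  by (simp add: algebra_simps)

lemma root_increment_integral:
  assumes "j \<in> layers L B"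
  shows "branch_R L integrable_on {of_int j * B .. of_int j * B + B}"
    and "root (j + 1) - root j = B / L + 1 / L * integral {of_int j * B .. of_int j * B + B} (branch_R L)"
  using branch_increment_integral[OF L_pos, of "of_int j * B" B] assms B_pos
  unfolding root_Suc by (auto simp: layers_def)

lemma root_increment_gt: "j \<in> layers L B \<Longrightarrow> B / L < root (j + 1) - root j"
  unfolding root_Suc using branch_increment_bounds(1)[OF L_pos _ B_pos] by (simp add: layers_def)

lemma root_increment_strict_antimono:
  "strict_antimono_on (layers L B) (\<lambda>j. root (j + 1) - root j)"
  unfolding root_Suc using branch_increment_strict_antimono[OF L_pos _ B_pos] B_pos
  by (auto simp: monotone_on_def layers_def)

lemma root_increment_tendsto: "((\<lambda>j. root (j + 1) - root j) \<longlongrightarrow> B / L) at_top"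
  unfolding root_Suc
  by (rule filterlim_compose[OF branch_increment_tendsto[OF L_pos B_pos] level_at_top])

text \<open>Applying the increasing map \<open>\<phi> u = L * u - ln u\<close> to \<open>x\<^sub>j\<^sub>+\<^sub>1 < x\<^sub>j + h\<close> and subtracting \<open>\<phi> (x\<^sub>j) = j * B\<close> leaves
\<open>ln (1 + h / x\<^sub>j) < L * h - B\<close>, which can be solved for \<open>x\<^sub>j\<close>.\<close>

lemma root_increment_less_iff:
  fixes h :: real
  assumes j: "j \<in> layers L B" and h: "B / L < h"
  shows "root (j + 1) - root j < h \<longleftrightarrow> root j > h / (exp (L * (h - B / L)) - 1)"
proof -
  have h0: "h > 0" using h L_pos B_pos by (meson divide_pos_pos less_trans)
  have Lh: "L * (h - B / L) = L * h - B" using L_pos by (simp add: field_simps)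
  have E: "exp (L * h - B) > 1" using h L_pos by (simp add: field_simps)
  have x: "root j > 0" "root j > 1 / L" "L * root j - ln (root j) = of_int j * B"
    using root_pos[OF j] branch_root[OF L_pos] j by (auto simp: layers_def)
  have j1: "of_int j * B + B > 1 + ln L" using j B_pos by (simp add: layers_def)
  have "root (j + 1) - root j < h \<longleftrightarrow> large_branch L (of_int j * B + B) < root j + h"
    unfolding root_Suc by auto
  also have "\<dots> \<longleftrightarrow> of_int j * B + B < L * (root j + h) - ln (root j + h)"
    using branch_less_iff[OF L_pos j1] x(2) h0 by simp
  also have "\<dots> \<longleftrightarrow> ln (root j + h) - ln (root j) < L * h - B"
    using x(3) by (auto simp: algebra_simps)
  also have "ln (root j + h) - ln (root j) = ln ((root j + h) / root j)"
    using x h0 by (simp add: ln_div)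
  also have "\<dots> < L * h - B \<longleftrightarrow> (root j + h) / root j < exp (L * h - B)"
    using x h0 by (metis add_pos_pos divide_pos_pos exp_less_cancel_iff exp_ln)
  also have "\<dots> \<longleftrightarrow> root j > h / (exp (L * h - B) - 1)"
    using x E by (simp add: field_simps)
  finally show ?thesis unfolding Lh .
qed

subsection \<open>Counting long gaps\<close>

text \<open>An increment strictly between \<open>k\<close> and \<open>k + 1\<close> moves the ceiling by one of the two; the lower bound holds in every layer because \<open>d\<^sub>j > a \<ge> k\<close>.\<close>

lemma ceil_root_gap:
  assumes "j \<in> layers L B" and "root (j + 1) - root j < of_int min_gap + 1"
  shows "ceil_root (j + 1) - ceil_root j \<in> {min_gap, min_gap + 1}"
proof -
  have "of_int min_gap < root (j + 1) - root j"
    using root_increment_gt[OF assms(1)] of_int_floor_le[of "B / L"] by linarith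
  with assms(2) have "ceil_root (j + 1) - ceil_root j \<ge> min_gap"
     "ceil_root (j + 1) - ceil_root j \<le> min_gap + 1"
    by linarith+
  then show ?thesis by auto
qed

lemma eventually_two_gaps: "\<exists>j0. two_gaps_from j0"
proof -
  have "\<forall>\<^sub>F j in at_top. root (j + 1) - root j < of_int min_gap + 1"
    by (rule order_tendstoD(2)[OF root_increment_tendsto]) linarith
  with eventually_layers
  have "\<forall>\<^sub>F j in at_top. j \<in> layers L B \<and> ceil_root (j + 1) - ceil_root j \<in> {min_gap, min_gap + 1}"
    by eventually_elim (use ceil_root_gap in blast)
  then show ?thesis unfolding eventually_at_top_linorder by blast
qed

lemma two_gaps_from_mono: "two_gaps_from i \<Longrightarrow> i \<le> j \<Longrightarrow> two_gaps_from j"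
  using layers_upward[of i j] by auto

text \<open>Each gap exceeds \<open>k\<close> by \<open>0\<close> or \<open>1\<close>, and by \<open>1\<close> exactly when it is long, so the count is the telescoping
sum of the excesses.\<close>

lemma card_long_gaps:
  assumes "two_gaps_from r" and "r \<le> s"
  shows "int (card (long_gaps r s)) = ceil_root s - ceil_root r - min_gap * (s - r)"
  using assms(2)
proof (induction s rule: int_ge_induct)
  case base
  have "long_gaps r r = {}" by (auto simp: long_gaps_def)
  then show ?case by simp
next
  case (step i)
  have fin: "finite (long_gaps r i)" by (rule finite_subset[of _ "{r..<i}"]) (auto simp: long_gaps_def)
  have gap: "ceil_root (i + 1) - ceil_root i \<in> {min_gap, min_gap + 1}" using assms(1) step.hyps by blast
  show ?case
  proof (cases "ceil_root (i + 1) - ceil_root i = min_gap + 1")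
    case True
    then have "long_gaps r (i + 1) = insert i (long_gaps r i)" using step.hyps by (auto simp: long_gaps_def)
    moreover have "i \<notin> long_gaps r i" by (simp add: long_gaps_def)
    ultimately have "card (long_gaps r (i + 1)) = Suc (card (long_gaps r i))" using fin by simp
    then show ?thesis using step.IH True by (simp add: algebra_simps)
  next
    case False
    then have "long_gaps r (i + 1) = long_gaps r i" by (auto simp: long_gaps_def order_less_le)
    then show ?thesis using step.IH gap False by (simp add: algebra_simps)
  qed
qed

text \<open>No error term yet: the two substitutions \<open>m\<^sub>j = x\<^sub>j + d\<^sub>+(x\<^sub>j)\<close> and \<open>x\<^sub>j = a * j + ln (x\<^sub>j) / L\<close> in the
telescoped count are identities. The fractional part of \<open>a\<close> appears as \<open>a - k\<close>.\<close>

lemma card_long_gaps_exact: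
  assumes "two_gaps_from r" and "r \<le> s"
  shows "real (card (long_gaps r s)) = frac (B / L) * of_int (s - r)
           + (ln (root s) - ln (root r)) / L + d_plus (root s) - d_plus (root r)"
proof -
  have r: "r \<in> layers L B" using assms(1) by blast
  then have s: "s \<in> layers L B" using assms(2) layers_upward by blast
  have "real (card (long_gaps r s)) = of_int (int (card (long_gaps r s)))" by simp
  also have "\<dots> = of_int (ceil_root s) - of_int (ceil_root r) - of_int min_gap * of_int (s - r)"
    unfolding card_long_gaps[OF assms] by simp
  also have "\<dots> = root s - root r - of_int min_gap * of_int (s - r) + d_plus (root s) - d_plus (root r)"
    by (simp add: d_plus_def)
  also have "root s - root r = B / L * of_int (s - r) + (ln (root s) - ln (root r)) / L"
    using root_eq[OF r] root_eq[OF s] by (simp add: algebra_simps diff_divide_distrib)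
  finally show ?thesis by (simp add: frac_def algebra_simps)
qed

subsection \<open>Logarithmic size of the roots\<close>

text \<open>Dividing \<open>x\<^sub>j = a * j + ln (x\<^sub>j) / L\<close> by \<open>a * j\<close> gives \<open>x\<^sub>j / (a * j) = 1 + ln (x\<^sub>j) / (B * j)\<close>, whose logarithm is
the quantity to be bounded; it lies between \<open>0\<close> and \<open>ln (x\<^sub>j) / (B * j)\<close>. A crude bound \<open>x\<^sub>j \<le> 2 * a * j\<close>,
from \<open>ln u \<le> L * u / 2\<close> for large \<open>u\<close>, then makes the numerator \<open>O(ln j)\<close>. The bound \<open>3 \<le> r0\<close> ensures
\<open>ln j \<ge> 1\<close>, so that constants can be absorbed, and puts all indices where \<open>ln j / j\<close> decreases.\<close>

lemma ln_root_approx: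
  obtains C r0 where "0 \<le> C" "3 \<le> r0" "r0 \<in> layers L B"
    "\<And>j. r0 \<le> j \<Longrightarrow> \<bar>ln (root j) - ln (of_int j) - ln (B / L)\<bar> \<le> C * (ln (of_int j) / of_int j)"
proof -
  define a where "a = B / L"
  have a: "a > 0" using L_pos B_pos by (simp add: a_def)
  have "\<forall>\<^sub>F u in at_top. ln u / u < L / 2"
    using L_pos by (intro order_tendstoD(2)[OF ln_x_over_x_tendsto_0]) simp
  then have "\<forall>\<^sub>F u in at_top. ln u \<le> L / 2 * u"
    using eventually_gt_at_top[of 0] by eventually_elim (simp add: pos_divide_less_eq)
  then have "\<forall>\<^sub>F j in at_top. ln (root j) \<le> L / 2 * root j"
    using root_at_top by (rule eventually_compose_filterlim)
  moreover have "\<forall>\<^sub>F j in at_top. root j \<ge> 1"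
    using root_at_top[unfolded filterlim_at_top, rule_format, of 1] .
  ultimately have "\<forall>\<^sub>F j in at_top. j \<in> layers L B \<and> ln (root j) \<le> L / 2 * root j \<and> root j \<ge> 1 \<and> 3 \<le> j"
    using eventually_layers eventually_ge_at_top[of 3] by eventually_elim auto
  then obtain r0 where r0: "\<And>j. r0 \<le> j \<Longrightarrow>
      j \<in> layers L B \<and> ln (root j) \<le> L / 2 * root j \<and> root j \<ge> 1 \<and> 3 \<le> j"
    unfolding eventually_at_top_linorder by blast
  define C where "C = (\<bar>ln (2 * a)\<bar> + 1) / B"
  show thesis
  proof (rule that[of C r0])
    show "0 \<le> C" using B_pos by (simp add: C_def)
    fix j assume "r0 \<le> j"
    with r0 have j: "j \<in> layers L B" "ln (root j) \<le> L / 2 * root j" "root j \<ge> 1" "3 \<le> j" by auto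
    define t where "t = (of_int j :: real)"
    have t: "t \<ge> 3" using j(4) by (simp add: t_def)
    have at: "a * t > 0" using a t by simp
    have eq: "root j = a * t + ln (root j) / L" using root_eq[OF j(1)] by (simp add: a_def t_def)
    have lnx: "ln (root j) \<ge> 0" using j(3) by simp
    have lnt: "ln t \<ge> 1"
      using exp_le t by (subst ln_ge_iff) auto
    have "ln (root j) / L \<le> root j / 2" using j(2) L_pos by (simp add: field_simps)
    with eq have "root j \<le> 2 * a * t" by linarith
    then have "ln (root j) \<le> ln (2 * a * t)" using j(3) by simp
    also have "\<dots> = ln (2 * a) + ln t" using a t by (simp add: ln_mult)
    also have "\<dots> \<le> (\<bar>ln (2 * a)\<bar> + 1) * ln t"
      using mult_left_mono[OF lnt, of "\<bar>ln (2 * a)\<bar>"] by (simp add: algebra_simps)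
    finally have up: "ln (root j) \<le> (\<bar>ln (2 * a)\<bar> + 1) * ln t" .
    have r: "root j / (a * t) = 1 + ln (root j) / (B * t)"
    proof -
      have "root j / (a * t) = (a * t + ln (root j) / L) / (a * t)" using eq by metis
      also have "\<dots> = 1 + ln (root j) / L / (a * t)" using a t by (simp add: add_divide_distrib)
      also have "ln (root j) / L / (a * t) = ln (root j) / (B * t)"
        using L_pos B_pos t by (simp add: a_def)
      finally show ?thesis .
    qed
    have q: "ln (root j) / (B * t) \<ge> 0" using lnx B_pos t by simp
    have e: "ln (root j) - ln t - ln a = ln (root j / (a * t))"
      using a t j(3) by (simp add: ln_div ln_mult)
    have "ln (root j / (a * t)) \<ge> 0" unfolding r using q by simp
    moreover have "ln (root j / (a * t)) \<le> ln (root j) / (B * t)"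
      unfolding r using q by (rule ln_add_one_self_le_self)
    moreover have "ln (root j) / (B * t) \<le> C * (ln t / t)"
      using up B_pos t by (simp add: C_def divide_simps mult.commute)
    ultimately show "\<bar>ln (root j) - ln (of_int j) - ln (B / L)\<bar> \<le> C * (ln (of_int j) / of_int j)"
      using e unfolding t_def a_def by linarith
  qed (use r0 in auto)
qed

lemma ln_div_self_antimono:
  fixes r s :: int
  assumes "3 \<le> r" "r \<le> s"
  shows "ln (of_int s) / of_int s \<le> ln (of_int r) / (of_int r :: real)"
  using exp_le assms by (intro ln_x_over_x_mono) (auto intro: order_trans[of _ 3])

text \<open>In the exact count, replacing \<open>ln (x\<^sub>s) - ln (x\<^sub>r)\<close> by \<open>ln (s / r)\<close> costs the difference of the errors of
\<open>ln_root_approx\<close> at \<open>s\<close> and \<open>r\<close>; the error at \<open>s\<close> obeys the bound for \<open>r\<close> because \<open>ln j / j\<close> decreases.\<close>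

lemma long_gaps_uniform:
  "\<exists>C. \<exists>r0\<in>layers L B. r0 \<ge> 1 \<and> (\<forall>r s. r0 \<le> r \<and> r < s \<longrightarrow>
        \<bar>real (card (long_gaps r s))
          - (frac (B / L) * of_int (s - r) + 1 / L * ln (of_int s / of_int r) + d_plus (root s) - d_plus (root r))\<bar>
          \<le> C * (ln (of_int r) / of_int r))"
proof -
  obtain C r1 where C: "0 \<le> C" "3 \<le> r1" "r1 \<in> layers L B"
    and approx: "\<And>j. r1 \<le> j \<Longrightarrow> \<bar>ln (root j) - ln (of_int j) - ln (B / L)\<bar> \<le> C * (ln (of_int j) / of_int j)"
    using ln_root_approx by blast
  obtain j0 where j0: "two_gaps_from j0" using eventually_two_gaps by blast
  define r0 where "r0 = max r1 j0"
  show ?thesis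
  proof (intro exI bexI conjI allI impI)
    show "r0 \<in> layers L B" "1 \<le> r0" using C layers_upward[of r1 r0] by (auto simp: r0_def)
    fix r s assume "r0 \<le> r \<and> r < s"
    then have rs: "r0 \<le> r" "r < s" by auto
    then have r: "two_gaps_from r" "3 \<le> r" "r1 \<le> r" using two_gaps_from_mono[OF j0, of r] C(2)
      by (auto simp: r0_def)
    define E where "E = (\<lambda>j. ln (root j) - ln (of_int j) - ln (B / L))"
    have "\<bar>E r\<bar> \<le> C * (ln (of_int r) / of_int r)" using approx r by (simp add: E_def)
    moreover have "\<bar>E s\<bar> \<le> C * (ln (of_int r) / of_int r)"
      using approx[of s] mult_left_mono[OF ln_div_self_antimono[of r s] C(1)] r rs by (simp add: E_def)
    ultimately have "\<bar>E s - E r\<bar> \<le> 2 * C * (ln (of_int r) / of_int r)" by linarith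
    then have "\<bar>E s - E r\<bar> / L \<le> 2 * C * (ln (of_int r) / of_int r) / L"
      using L_pos by (intro divide_right_mono) auto
    moreover have "real (card (long_gaps r s)) - (frac (B / L) * of_int (s - r) + 1 / L * ln (of_int s / of_int r)
          + d_plus (root s) - d_plus (root r)) = (E s - E r) / L"
      using card_long_gaps_exact[OF r(1), of s] rs r(2)
      by (simp add: E_def ln_div diff_divide_distrib add_divide_distrib algebra_simps)
    ultimately show "\<bar>real (card (long_gaps r s)) - (frac (B / L) * of_int (s - r) + 1 / L * ln (of_int s / of_int r)
          + d_plus (root s) - d_plus (root r))\<bar> \<le> 2 * C / L * (ln (of_int r) / of_int r)"
      using L_pos by (simp add: mult.commute)
  qed
qed

lemma d_plus_bounds: "0 \<le> d_plus t" "d_plus t < 1"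
  unfolding d_plus_def by linarith+

text \<open>Both \<open>d\<^sub>+\<close> values lie in \<open>[0, 1)\<close>, so their difference is strictly less than \<open>1\<close> in absolute value.\<close>

lemma long_gaps_discrepancy:
  "\<exists>C. \<exists>r0\<in>layers L B. r0 \<ge> 1 \<and> (\<forall>r s. r0 \<le> r \<and> r < s \<longrightarrow>
        \<bar>real (card (long_gaps r s)) - frac (B / L) * of_int (s - r) - 1 / L * ln (of_int s / of_int r)\<bar>
          < 1 + C * (ln (of_int r) / of_int r))"
proof -
  obtain C r0 where C: "r0 \<in> layers L B" "1 \<le> r0" and uniform: "\<forall>r s. r0 \<le> r \<and> r < s \<longrightarrow>
        \<bar>real (card (long_gaps r s))
          - (frac (B / L) * of_int (s - r) + 1 / L * ln (of_int s / of_int r) + d_plus (root s) - d_plus (root r))\<bar>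
          \<le> C * (ln (of_int r) / of_int r)"
    using long_gaps_uniform by blast
  show ?thesis
  proof (intro exI bexI conjI allI impI)
    fix r s assume "r0 \<le> r \<and> r < s"
    then show "\<bar>real (card (long_gaps r s)) - frac (B / L) * of_int (s - r) - 1 / L * ln (of_int s / of_int r)\<bar>
         < 1 + C * (ln (of_int r) / of_int r)"
      using uniform[rule_format, of r s] d_plus_bounds[of "root r"] d_plus_bounds[of "root s"] by linarith
  qed (use C in auto)
qed

text \<open>For large \<open>N\<close> the exact count differs from \<open>\<theta> * N + ln N / L\<close> by terms depending on \<open>j0\<close> only, two
values of \<open>d\<^sub>+\<close>, and the bounded error of \<open>ln_root_approx\<close>. The finitely many remaining \<open>N \<ge> 1\<close> are
covered by adding up their discrepancies \<open>F N\<close>.\<close>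

lemma long_gaps_growth:
  assumes j0: "two_gaps_from j0"
  obtains C where "\<And>N. j0 < N \<Longrightarrow> 1 \<le> N \<Longrightarrow>
    \<bar>real (card (long_gaps j0 N)) - (frac (B / L) * of_int N + ln (of_int N) / L)\<bar> \<le> C"
proof -
  define F where "F = (\<lambda>N. \<bar>real (card (long_gaps j0 N)) - (frac (B / L) * of_int N + ln (of_int N) / L)\<bar>)"
  obtain C r1 where C: "0 \<le> C" "3 \<le> r1" "r1 \<in> layers L B"
    and approx: "\<And>j. r1 \<le> j \<Longrightarrow> \<bar>ln (root j) - ln (of_int j) - ln (B / L)\<bar> \<le> C * (ln (of_int j) / of_int j)"
    using ln_root_approx by blast
  define X where "X = (C + \<bar>ln (B / L) - ln (root j0)\<bar>) / L"
  define Y where "Y = frac (B / L) * of_int j0"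
  have large: "F N \<le> X + 1 + \<bar>Y\<bar>" if N: "r1 \<le> N" "j0 < N" for N
  proof -
    define E where "E = ln (root N) - ln (of_int N) - ln (B / L)"
    have "ln (of_int N) / of_int N \<le> (1::real)"
      using ln_le_minus_one[of "of_int N"] N C(2) by (simp add: divide_le_eq)
    then have "\<bar>E\<bar> \<le> C"
      using approx[OF N(1)] mult_left_mono[OF _ C(1)] unfolding E_def by fastforce
    then have "\<bar>(E + (ln (B / L) - ln (root j0))) / L\<bar> \<le> X"
      unfolding abs_divide X_def using L_pos by (simp add: divide_right_mono)
    moreover have "real (card (long_gaps j0 N)) - (frac (B / L) * of_int N + ln (of_int N) / L)
        = (E + (ln (B / L) - ln (root j0))) / L + d_plus (root N) - d_plus (root j0) - Y"
      using card_long_gaps_exact[OF j0, of N] N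
      by (simp add: E_def Y_def algebra_simps diff_divide_distrib add_divide_distrib)
    ultimately show ?thesis
      using d_plus_bounds[of "root N"] d_plus_bounds[of "root j0"]
      unfolding F_def by linarith
  qed
  define S where "S = (\<Sum>N\<in>{1..r1}. F N)"
  have F0: "F N \<ge> 0" for N by (simp add: F_def)
  have S0: "S \<ge> 0" unfolding S_def using F0 by (simp add: sum_nonneg)
  have X0: "X \<ge> 0" using C(1) L_pos by (simp add: X_def)
  have "F N \<le> S + (X + 1 + \<bar>Y\<bar>)" if "j0 < N" "1 \<le> N" for N
  proof (cases "r1 \<le> N")
    case True
    then show ?thesis using large[of N] that S0 by simp
  next
    case False
    then have "F N \<le> S" unfolding S_def using that F0 by (intro member_le_sum) auto
    then show ?thesis using X0 by simp
  qed
  then show thesis using that[of "S + (X + 1 + \<bar>Y\<bar>)"] unfolding F_def by blast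
qed

text \<open>Otherwise the counts would be bounded, although they are at least \<open>ln N / L - C\<close>.\<close>

lemma infinite_long_gaps:
  "infinite {j \<in> layers L B. ceil_root (j + 1) - ceil_root j = min_gap + 1}" (is "infinite ?S")
proof
  assume fin: "finite ?S"
  obtain j0 where j0: "two_gaps_from j0" using eventually_two_gaps by blast
  obtain C where C: "\<And>N. j0 < N \<Longrightarrow> 1 \<le> N \<Longrightarrow>
    \<bar>real (card (long_gaps j0 N)) - (frac (B / L) * of_int N + ln (of_int N) / L)\<bar> \<le> C"
    using long_gaps_growth[OF j0] by blast
  \<comment> \<open>chosen so that \<open>ln N / L - C\<close> exceeds the supposed total number of long gaps\<close>
  define N where "N = max (max 1 (j0 + 1)) \<lceil>exp (L * (real (card ?S) + C + 1))\<rceil>"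
  have N: "j0 < N" "1 \<le> N" by (auto simp: N_def)
  have "exp (L * (real (card ?S) + C + 1)) \<le> of_int N" unfolding N_def by linarith
  then have "L * (real (card ?S) + C + 1) \<le> ln (of_int N)" using N(2) by (simp add: ln_ge_iff)
  then have "real (card ?S) + C + 1 \<le> ln (of_int N) / L" using L_pos by (simp add: field_simps)
  moreover have "frac (B / L) * of_int N \<ge> 0" using N(2) by simp
  moreover have "card (long_gaps j0 N) \<le> card ?S"
    unfolding long_gaps_def using fin j0 by (intro card_mono) (auto intro: layers_upward)
  ultimately show False using C[OF N] by linarith
qed

subsection \<open>Which integers are ceilings\<close>

text \<open>Both sides say that \<open>j * B \<le> L * M - ln M\<close>: on the left because \<open>x\<^sub>j \<le> M\<close> may be tested after applying the
increasing map \<open>u \<mapsto> L * u - ln u\<close>, provided that \<open>M\<close> also lies to the right of \<open>1/L\<close>.\<close>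

lemma ceil_root_le_iff:
  assumes j: "j \<in> layers L B" and M: "of_int M > 1 / L"
  shows "ceil_root j \<le> M \<longleftrightarrow> j \<le> \<lfloor>(L * of_int M - ln (of_int M)) / B\<rfloor>"
  using branch_le_iff[OF L_pos _ M] j B_pos
  by (simp add: layers_def ceiling_le_iff le_floor_iff pos_le_divide_eq)

lemma card_ceil_root_le:
  assumes j0: "j0 \<in> layers L B" and M: "of_int M > 1 / L"
  shows "finite {j. j0 \<le> j \<and> ceil_root j \<le> M}"
    and "int (card {j. j0 \<le> j \<and> ceil_root j \<le> M})
           = max 0 (\<lfloor>(L * of_int M - ln (of_int M)) / B\<rfloor> - j0 + 1)"
proof -
  have "{j. j0 \<le> j \<and> ceil_root j \<le> M} = {j0..\<lfloor>(L * of_int M - ln (of_int M)) / B\<rfloor>}"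
    using ceil_root_le_iff[OF layers_upward[OF j0] M] by auto
  then show "finite {j. j0 \<le> j \<and> ceil_root j \<le> M}"
    "int (card {j. j0 \<le> j \<and> ceil_root j \<le> M})
           = max 0 (\<lfloor>(L * of_int M - ln (of_int M)) / B\<rfloor> - j0 + 1)"
    by (auto simp: max_def)
qed

text \<open>Applied to \<open>M\<close> and \<open>M - 1\<close>, the previous criterion says that \<open>M = m\<^sub>j\<close> iff
\<open>\<lfloor>\<Phi> (M - 1)\<rfloor> < j \<le> \<lfloor>\<Phi> M\<rfloor>\<close>. As \<open>\<Phi> M - \<Phi> (M - 1) < L / B < 1\<close>, there is at most one such \<open>j\<close>. The set \<open>S\<close> of
admissible layers is a parameter, required only to contain every integer beyond \<open>\<Phi> (M - 1)\<close>, so that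
the same argument serves all layers and those from a given one on.\<close>

lemma ceil_root_indicator:
  fixes M :: int
  defines "\<Phi> \<equiv> \<lambda>t. (L * t - ln t) / B"
  assumes LB: "L < B" and M: "of_int (M - 1) > 1 / L" and S: "S \<subseteq> layers L B"
    and S': "\<And>j. \<Phi> (of_int (M - 1)) < of_int j \<Longrightarrow> j \<in> S"
  shows "of_bool (\<exists>j\<in>S. M = ceil_root j) = \<lfloor>\<Phi> (of_int M)\<rfloor> - \<lfloor>\<Phi> (of_int (M - 1))\<rfloor>"
proof -
  have M': "of_int M > 1 / L" using M by simp
  have M0: "of_int (M - 1) > (0::real)" using M L_pos by (meson less_trans zero_less_divide_1_iff)
  have hit: "M = ceil_root j \<longleftrightarrow> \<lfloor>\<Phi> (of_int (M - 1))\<rfloor> < j \<and> j \<le> \<lfloor>\<Phi> (of_int M)\<rfloor>" if "j \<in> layers L B" for j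
    using ceil_root_le_iff[OF that M] ceil_root_le_iff[OF that M'] unfolding \<Phi>_def by linarith
  have "L * of_int (M - 1) - ln (of_int (M - 1)) < L * of_int M - ln (of_int M)"
    using strict_mono_onD[OF branch_strict_mono[OF L_pos], of "of_int (M - 1)" "of_int M"] M M' by simp
  then have "\<Phi> (of_int (M - 1)) \<le> \<Phi> (of_int M)"
    unfolding \<Phi>_def using B_pos by (intro divide_right_mono) auto
  then have le: "\<lfloor>\<Phi> (of_int (M - 1))\<rfloor> \<le> \<lfloor>\<Phi> (of_int M)\<rfloor>" by (rule floor_mono)
  have "ln (of_int (M - 1)) < ln (of_int M :: real)" using M0 by simp
  then have "L * of_int M - ln (of_int M) < (L * of_int (M - 1) - ln (of_int (M - 1))) + B"
    using LB by (simp add: algebra_simps)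
  then have "\<Phi> (of_int M) < ((L * of_int (M - 1) - ln (of_int (M - 1))) + B) / B"
    unfolding \<Phi>_def using B_pos by (rule divide_strict_right_mono)
  then have "\<Phi> (of_int M) < \<Phi> (of_int (M - 1)) + 1"
    unfolding \<Phi>_def using B_pos by (simp add: add_divide_distrib)
  then have up: "\<lfloor>\<Phi> (of_int M)\<rfloor> \<le> \<lfloor>\<Phi> (of_int (M - 1))\<rfloor> + 1" by linarith
  show ?thesis
  proof (cases "\<lfloor>\<Phi> (of_int M)\<rfloor> = \<lfloor>\<Phi> (of_int (M - 1))\<rfloor>")
    case True
    then have "\<not> (\<exists>j\<in>S. M = ceil_root j)" using hit S by fastforce
    then show ?thesis using True by simp
  next
    case False
    define j where "j = \<lfloor>\<Phi> (of_int M)\<rfloor>"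
    have j: "j = \<lfloor>\<Phi> (of_int (M - 1))\<rfloor> + 1" using False le up unfolding j_def by linarith
    then have "\<Phi> (of_int (M - 1)) < of_int j" by linarith
    then have "j \<in> S" by (rule S')
    moreover have "\<lfloor>\<Phi> (of_int (M - 1))\<rfloor> < j" "j \<le> \<lfloor>\<Phi> (of_int M)\<rfloor>" using j unfolding j_def by linarith+
    ultimately have "\<exists>j\<in>S. M = ceil_root j" using hit S by blast
    moreover have "\<lfloor>\<Phi> (of_int M)\<rfloor> - \<lfloor>\<Phi> (of_int (M - 1))\<rfloor> = 1" using j unfolding j_def by linarith
    ultimately show ?thesis by (simp only: of_bool_eq_1_iff)
  qed
qed

text \<open>Once \<open>M - 1 \<ge> x\<^bsub>j0\<^esub>\<close> we have \<open>\<Phi> (M - 1) \<ge> j0\<close>, so every integer beyond \<open>\<Phi> (M - 1)\<close> is at least \<open>j0\<close>.\<close>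

lemma ceil_root_indicator_from:
  assumes LB: "L < B" and j0: "j0 \<in> layers L B"
  shows "\<exists>M0::int. \<forall>M\<ge>M0. of_bool (\<exists>j\<ge>j0. M = ceil_root j)
    = \<lfloor>(L * of_int M - ln (of_int M)) / B\<rfloor> - \<lfloor>(L * of_int (M - 1) - ln (of_int (M - 1))) / B\<rfloor>"
proof (intro exI allI impI)
  fix M assume "M \<ge> ceil_root j0 + 1"
  then have x: "root j0 \<le> of_int (M - 1)" by linarith
  have root: "root j0 > 1 / L" using branch_root(1)[OF L_pos] j0 by (simp add: layers_def)
  with x have M: "of_int (M - 1) > 1 / L" by linarith
  have "of_int j0 * B \<le> L * of_int (M - 1) - ln (of_int (M - 1))"
    using branch_le_iff[OF L_pos _ M] x j0 by (simp add: layers_def)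
  then have "of_int j0 \<le> (L * of_int (M - 1) - ln (of_int (M - 1))) / B"
    using B_pos by (simp add: field_simps)
  then have "j \<in> {j0..}" if "(L * of_int (M - 1) - ln (of_int (M - 1))) / B < of_int j" for j
    using that by simp
  moreover have "{j0..} \<subseteq> layers L B" using layers_upward[OF j0] by auto
  ultimately show "of_bool (\<exists>j\<ge>j0. M = ceil_root j)
    = \<lfloor>(L * of_int M - ln (of_int M)) / B\<rfloor> - \<lfloor>(L * of_int (M - 1) - ln (of_int (M - 1))) / B\<rfloor>"
    using ceil_root_indicator[OF LB M, of "{j0..}"] by (simp add: Bex_def)
qed

text \<open>Any \<open>j > \<Phi> (M - 1)\<close> is a layer as soon as \<open>M - 1 > 1/L\<close>, since \<open>B * \<Phi> (M - 1)\<close> then exceeds the minimum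
\<open>1 + ln L\<close>.\<close>

lemma ceil_root_indicator_all:
  assumes LB: "L < B"
  shows "\<exists>M0::int. \<forall>M\<ge>M0. of_bool (\<exists>j\<in>layers L B. M = ceil_root j)
    = \<lfloor>(L * of_int M - ln (of_int M)) / B\<rfloor> - \<lfloor>(L * of_int (M - 1) - ln (of_int (M - 1))) / B\<rfloor>"
proof (intro exI allI impI)
  fix M assume "M \<ge> \<lfloor>1 / L\<rfloor> + 2"
  then have M: "of_int (M - 1) > 1 / L" by linarith
  have "j \<in> layers L B" if "(L * of_int (M - 1) - ln (of_int (M - 1))) / B < of_int j" for j
    using that level_gt_minimum[OF L_pos M] B_pos by (simp add: layers_def pos_divide_less_eq)
  then show "of_bool (\<exists>j\<in>layers L B. M = ceil_root j)
    = \<lfloor>(L * of_int M - ln (of_int M)) / B\<rfloor> - \<lfloor>(L * of_int (M - 1) - ln (of_int (M - 1))) / B\<rfloor>"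
    using ceil_root_indicator[OF LB M, of "layers L B"] by blast
qed

text \<open>The increment \<open>G (j * B + L) - G (j * B)\<close> exceeds \<open>L / L = 1\<close> and tends to \<open>1\<close>; subtracting \<open>1\<close> leaves the
length of \<open>[x\<^sub>j, z\<^sub>j)\<close>.\<close>

lemma eventually_one_candidate:
  "\<exists>j0::int. \<forall>j\<ge>j0. of_int j * B > 1 + ln L \<and> of_int j * B + L > 1 + ln L
     \<and> 0 < (large_branch L (of_int j * B + L) - 1) - root j
     \<and> (large_branch L (of_int j * B + L) - 1) - root j < 1"
proof -
  have "((\<lambda>j. large_branch L (of_int j * B + L) - root j) \<longlongrightarrow> L / L) at_top"
    by (rule filterlim_compose[OF branch_increment_tendsto[OF L_pos L_pos] level_at_top])
  then have "\<forall>\<^sub>F j in at_top. large_branch L (of_int j * B + L) - root j < 2"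
    using L_pos by (intro order_tendstoD(2)) auto
  with eventually_layers have "\<forall>\<^sub>F j::int in at_top. of_int j * B > 1 + ln L \<and> of_int j * B + L > 1 + ln L
     \<and> 0 < (large_branch L (of_int j * B + L) - 1) - root j
     \<and> (large_branch L (of_int j * B + L) - 1) - root j < 1"
  proof eventually_elim
    case (elim j)
    then show ?case
      using branch_increment_bounds(1)[OF L_pos, of "of_int j * B" L] L_pos by (simp add: layers_def)
  qed
  then show ?thesis unfolding eventually_at_top_linorder by blast
qed

end

section \<open>The gap theorem\<close>

theorem theorem3p5:
  fixes b :: nat and c \<rho> B L a \<theta> \<delta> :: real and k h :: int
    and x z d :: "int \<Rightarrow> real" and m :: "int \<Rightarrow> int"
    and D :: "int set" and long_gaps :: "int \<Rightarrow> int \<Rightarrow> int set"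
    and gaps_ok one_candidate :: "int \<Rightarrow> bool" and \<Phi> :: "real \<Rightarrow> real"
  assumes "b \<ge> 2" and "c \<ge> 2"
    and "\<rho> = frac (log (real b) c)" and "0 < \<rho>" and "\<rho> < 1"
    and "B = ln (real b)" and "L = \<rho> * B"
    and "D = layers L B"
    and "x = (\<lambda>j. large_branch L (of_int j * B))"
    and "z = (\<lambda>j. large_branch L (of_int j * B + L) - 1)"
    and "d = (\<lambda>j. x (j + 1) - x j)"
    and "m = (\<lambda>j. \<lceil>x j\<rceil>)"
    and "a = B / L" and "k = \<lfloor>a\<rfloor>" and "\<theta> = frac a"
    and "h = k + 1" and "\<delta> = of_int h - a"
    and "\<Phi> = (\<lambda>t. \<rho> * t - log (real b) t)"
    and "long_gaps = (\<lambda>r s. {j. r \<le> j \<and> j < s \<and> m (j + 1) - m j = k + 1})"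
    and "gaps_ok = (\<lambda>j0. j0 \<in> D \<and> (\<forall>j\<ge>j0. m (j + 1) - m j \<in> {k, k + 1}))"
    and "one_candidate = (\<lambda>j0. \<forall>j\<ge>j0.
           of_int j * B > 1 + ln L \<and> of_int j * B + L > 1 + ln L \<and> 0 < z j - x j \<and> z j - x j < 1)"
  shows
    "a = 1 / \<rho>
   \<and> (\<forall>j\<in>D. branch_R L integrable_on {of_int j * B .. of_int j * B + B}
        \<and> d j = a + 1 / L * integral {of_int j * B .. of_int j * B + B} (branch_R L))
   \<and> strict_antimono_on D d
   \<and> (\<forall>j\<in>D. a < d j)
   \<and> (d \<longlongrightarrow> a) at_top
   \<and> (\<forall>j\<in>D. d j < of_int h \<longleftrightarrow> x j > of_int h / (exp (L * \<delta>) - 1))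
   \<and> (\<exists>j0. gaps_ok j0)
   \<and> (\<forall>j0. gaps_ok j0 \<longrightarrow>
        (\<forall>N>j0. int (card (long_gaps j0 N)) = m N - m j0 - k * (N - j0))
      \<and> (\<exists>C. \<forall>N>j0. N \<ge> 1 \<longrightarrow>
           \<bar>real (card (long_gaps j0 N)) - (\<theta> * of_int N + ln (of_int N) / L)\<bar> \<le> C)
      \<and> (a \<in> \<int> \<longrightarrow> (\<exists>C. \<forall>N>j0. N \<ge> 1 \<longrightarrow>
           \<bar>real (card (long_gaps j0 N)) - ln (of_int N) / L\<bar> \<le> C)))
   \<and> (\<exists>C. \<exists>r0\<in>D. r0 \<ge> 1 \<and> (\<forall>r s. r0 \<le> r \<and> r < s \<longrightarrow>
        \<bar>real (card (long_gaps r s))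
          - (\<theta> * of_int (s - r) + 1 / L * ln (of_int s / of_int r) + d_plus (x s) - d_plus (x r))\<bar>
          \<le> C * (ln (of_int r) / of_int r)))
   \<and> (\<exists>C. \<exists>r0\<in>D. r0 \<ge> 1 \<and> (\<forall>r s. r0 \<le> r \<and> r < s \<longrightarrow>
        \<bar>real (card (long_gaps r s)) - \<theta> * of_int (s - r) - 1 / L * ln (of_int s / of_int r)\<bar>
          < 1 + C * (ln (of_int r) / of_int r)))
   \<and> infinite {j \<in> D. m (j + 1) - m j = k + 1}
   \<and> (\<exists>j0. one_candidate j0)
   \<and> (\<forall>j0. one_candidate j0 \<longrightarrow>
        (\<forall>M::int. of_int M > 1 / L \<longrightarrow>
           finite {j. j0 \<le> j \<and> m j \<le> M}
         \<and> int (card {j. j0 \<le> j \<and> m j \<le> M})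
             = max 0 (\<lfloor>\<rho> * of_int M - log (real b) (of_int M)\<rfloor> - j0 + 1))
      \<and> (\<exists>M0. \<forall>M\<ge>M0. of_bool (\<exists>j\<ge>j0. M = m j) = \<lfloor>\<Phi> (of_int M)\<rfloor> - \<lfloor>\<Phi> (of_int (M - 1))\<rfloor>))
   \<and> (\<exists>M0. \<forall>M\<ge>M0. of_bool (\<exists>j\<in>D. M = m j) = \<lfloor>\<Phi> (of_int M)\<rfloor> - \<lfloor>\<Phi> (of_int (M - 1))\<rfloor>)"
proof -
  have b: "ln (real b) > 0" using assms(1) by simp
  have B: "B > 0" using b assms(6) by simp
  have L: "L > 0" using B assms(4,7) by simp
  have LB: "L < B" using B assms(5,7) by simp
  interpret lay: log_layers L B using L B by unfold_locales
  have Phi: "\<rho> * t - log (real b) t = (L * t - ln t) / B" for t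
    using B b by (simp add: assms(6,7) log_def field_simps)
  have x: "x = lay.root" and m: "m = lay.ceil_root" and d: "d = (\<lambda>j. lay.root (j + 1) - lay.root j)"
    and k: "k = lay.min_gap" and D: "D = layers L B" and a: "a = B / L"
    by (simp_all add: assms(8-14))
  have gaps: "gaps_ok = lay.two_gaps_from" unfolding assms(20) m k D ..
  have long: "long_gaps = lay.long_gaps" unfolding assms(19) m k by (simp add: fun_eq_iff lay.long_gaps_def)
  have one: "one_candidate j0 \<Longrightarrow> j0 \<in> layers L B" for j0
    unfolding assms(21) layers_def by blast
  have "a = 1 / \<rho>" using B by (simp add: assms(7,13))
  moreover have "\<forall>j\<in>D. branch_R L integrable_on {of_int j * B .. of_int j * B + B}
        \<and> d j = a + 1 / L * integral {of_int j * B .. of_int j * B + B} (branch_R L)"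
    unfolding D d a using lay.root_increment_integral by blast
  moreover have "strict_antimono_on D d"
    unfolding D d by (rule lay.root_increment_strict_antimono)
  moreover have "\<forall>j\<in>D. a < d j" unfolding D d a using lay.root_increment_gt by blast
  moreover have "(d \<longlongrightarrow> a) at_top" unfolding d a by (rule lay.root_increment_tendsto)
  moreover have "\<forall>j\<in>D. d j < of_int h \<longleftrightarrow> x j > of_int h / (exp (L * \<delta>) - 1)"
  proof
    fix j assume "j \<in> D"
    moreover have "B / L < of_int h" unfolding assms(16) k by linarith
    ultimately show "d j < of_int h \<longleftrightarrow> x j > of_int h / (exp (L * \<delta>) - 1)"
      unfolding D d x assms(17) a by (rule lay.root_increment_less_iff)
  qed
  moreover have "\<exists>j0. gaps_ok j0" unfolding gaps by (rule lay.eventually_two_gaps)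
  moreover have "\<forall>j0. gaps_ok j0 \<longrightarrow>
        (\<forall>N>j0. int (card (long_gaps j0 N)) = m N - m j0 - k * (N - j0))
      \<and> (\<exists>C. \<forall>N>j0. N \<ge> 1 \<longrightarrow>
           \<bar>real (card (long_gaps j0 N)) - (\<theta> * of_int N + ln (of_int N) / L)\<bar> \<le> C)
      \<and> (a \<in> \<int> \<longrightarrow> (\<exists>C. \<forall>N>j0. N \<ge> 1 \<longrightarrow>
           \<bar>real (card (long_gaps j0 N)) - ln (of_int N) / L\<bar> \<le> C))"
  proof (intro allI impI)
    fix j0 assume "gaps_ok j0"
    then have j0: "lay.two_gaps_from j0" unfolding gaps .
    obtain C where C: "\<And>N. j0 < N \<Longrightarrow> 1 \<le> N \<Longrightarrow>
        \<bar>real (card (long_gaps j0 N)) - (\<theta> * of_int N + ln (of_int N) / L)\<bar> \<le> C"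
      using lay.long_gaps_growth[OF j0] unfolding long assms(15) a by blast
    moreover have "\<bar>real (card (long_gaps j0 N)) - ln (of_int N) / L\<bar> \<le> C"
      if "a \<in> \<int>" "j0 < N" "1 \<le> N" for N
      using C[OF that(2,3)] that(1) unfolding assms(15) by (simp add: frac_eq_0_iff[THEN iffD2])
    moreover have "int (card (long_gaps j0 N)) = m N - m j0 - k * (N - j0)" if "j0 < N" for N
      using lay.card_long_gaps[OF j0, of N] that unfolding long m k by simp
    ultimately show "(\<forall>N>j0. int (card (long_gaps j0 N)) = m N - m j0 - k * (N - j0))
      \<and> (\<exists>C. \<forall>N>j0. N \<ge> 1 \<longrightarrow>
           \<bar>real (card (long_gaps j0 N)) - (\<theta> * of_int N + ln (of_int N) / L)\<bar> \<le> C)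
      \<and> (a \<in> \<int> \<longrightarrow> (\<exists>C. \<forall>N>j0. N \<ge> 1 \<longrightarrow>
           \<bar>real (card (long_gaps j0 N)) - ln (of_int N) / L\<bar> \<le> C))"
      by blast
  qed
  moreover have "\<exists>C. \<exists>r0\<in>D. r0 \<ge> 1 \<and> (\<forall>r s. r0 \<le> r \<and> r < s \<longrightarrow>
        \<bar>real (card (long_gaps r s))
          - (\<theta> * of_int (s - r) + 1 / L * ln (of_int s / of_int r) + d_plus (x s) - d_plus (x r))\<bar>
          \<le> C * (ln (of_int r) / of_int r))"
    unfolding D long x assms(15) a by (rule lay.long_gaps_uniform)
  moreover have "\<exists>C. \<exists>r0\<in>D. r0 \<ge> 1 \<and> (\<forall>r s. r0 \<le> r \<and> r < s \<longrightarrow>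
        \<bar>real (card (long_gaps r s)) - \<theta> * of_int (s - r) - 1 / L * ln (of_int s / of_int r)\<bar>
          < 1 + C * (ln (of_int r) / of_int r))"
    unfolding D long assms(15) a by (rule lay.long_gaps_discrepancy)
  moreover have "infinite {j \<in> D. m (j + 1) - m j = k + 1}"
    unfolding D m k by (rule lay.infinite_long_gaps)
  moreover have "\<exists>j0. one_candidate j0"
    unfolding assms(21,10) x by (rule lay.eventually_one_candidate)
  moreover have "\<forall>j0. one_candidate j0 \<longrightarrow>
        (\<forall>M::int. of_int M > 1 / L \<longrightarrow>
           finite {j. j0 \<le> j \<and> m j \<le> M}
         \<and> int (card {j. j0 \<le> j \<and> m j \<le> M})
             = max 0 (\<lfloor>\<rho> * of_int M - log (real b) (of_int M)\<rfloor> - j0 + 1))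
      \<and> (\<exists>M0. \<forall>M\<ge>M0. of_bool (\<exists>j\<ge>j0. M = m j) = \<lfloor>\<Phi> (of_int M)\<rfloor> - \<lfloor>\<Phi> (of_int (M - 1))\<rfloor>)"
    unfolding assms(18) Phi m
    using lay.card_ceil_root_le[OF one] lay.ceil_root_indicator_from[OF LB one] by blast
  moreover have "\<exists>M0. \<forall>M\<ge>M0. of_bool (\<exists>j\<in>D. M = m j) = \<lfloor>\<Phi> (of_int M)\<rfloor> - \<lfloor>\<Phi> (of_int (M - 1))\<rfloor>"
    unfolding assms(18) Phi m D by (rule lay.ceil_root_indicator_all[OF LB])
  ultimately show ?thesis by (intro conjI)
qed

end
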